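(* Assume $\bar\Lambda\neq 0$ and put $\varepsilon_0:=(\bar\Lambda/\Lambda)^{1/2}\in(0,1]$. Then for any $\varepsilon\in(0,\varepsilon_0)$ and any $d\in\mathbb N$, $$n^{Z_d}\bigl(\varepsilon/\varepsilon_0+d^{-1/2}\bigr)-1\;\leqslant\; n^{Y_d}(\varepsilon)\;\leqslant\; n^{Z_d}\bigl(\varepsilon/\varepsilon_0\bigr)+1 .$$
   Context: $\mathbb N$ is the set of positive integers. $X_j(t)$, $t\in[0,1]$, $j\in\mathbb N$, are random processes on a common probability space, jointly measurable with sample paths in $L_2([0,1])$. All $X_j$ have zero mean and the same continuous covariance function $\mathcal K(t,s)=\mathbb E\,X_j(t)X_j(s)$, $t,s\in[0,1]$, and they are uncorrelated: $\mathbb E\,X_j(t)X_k(s)=0$ for $j\ne k$ and all $t,s$. For $d\in\mathbb N$ define $$Y_d(t):=\sum_{j=1}^d X_j(t_j),\quad t=(t_1,\dots,t_d)\in[0,1]^d,$$ $I_j:=\int_0^1 X_j(s)\,ds$, and $$Z_d(t):=Y_d(t)-\int_{[0,1]^d}Y_d(s)\,ds=\sum_{j=1}^d\bigl(X_j(t_j)-I_j\bigr),\quad t\in[0,1]^d.$$ Constants: $\Lambda:=\int_0^1\mathcal K(s,s)\,ds$, $\bar\lambda_0:=\int_0^1\int_0^1\mathcal K(t,s)\,dt\,ds$, $\bar\Lambda:=\Lambda-\bar\lambda_0$. $\langle\cdot,\cdot\rangle_{2,d}$ and $\|\cdot\|_{2,d}$ are the scalar product and norm of $L_2([0,1]^d)$.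 For a zero-mean random field $V_d$ with sample paths in $L_2([0,1]^d)$ put $e^{V_d}(0):=(\mathbb E\|V_d\|_{2,d}^2)^{1/2}$ and, for $n\in\mathbb N$, $$e^{V_d}(n):=\inf\Bigl\{\Bigl(\mathbb E\Bigl\|V_d-\sum_{m=1}^n\langle V_d,\psi_m\rangle_{2,d}\,\psi_m\Bigr\|_{2,d}^2\Bigr)^{1/2}:\ \psi_1,\dots,\psi_n\in L_2([0,1]^d)\Bigr\}.$$ The average case approximation complexity is $$n^{V_d}(\varepsilon):=\min\{n\in\mathbb N:\ e^{V_d}(n)\leqslant\varepsilon\, e^{V_d}(0)\}.$$ The same formula is used when the argument $\varepsilon$ is $\geqslant 1$ (in which case its value is $1$). *)

theory Defs
  imports "HOL-Probability.Probability"
begin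

abbreviation unit_leb :: "real measure" where
  "unit_leb \<equiv> restrict_space lborel {0..1}"

(* Points of the d-dimensional unit cube are functions with coordinates t 1, ..., t d
   (and value undefined elsewhere). *)
abbreviation cube :: "nat \<Rightarrow> (nat \<Rightarrow> real) measure" where
  "cube d \<equiv> (\<Pi>\<^sub>M j\<in>{1..d}. unit_leb)"

(* Square-integrable functions themselves, not classes modulo equality almost everywhere;
   everything below is invariant under changing them on null sets. *)
definition L2 :: "'b measure \<Rightarrow> ('b \<Rightarrow> real) set" where
  "L2 N = {f \<in> borel_measurable N. integrable N (\<lambda>x. (f x)\<^sup>2)}"

definition l2_inner :: "'b measure \<Rightarrow> ('b \<Rightarrow> real) \<Rightarrow> ('b \<Rightarrow> real) \<Rightarrow> real" where
  "l2_inner N f g = (\<integral>x. f x * g x \<partial>N)"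

definition l2_norm :: "'b measure \<Rightarrow> ('b \<Rightarrow> real) \<Rightarrow> real" where
  "l2_norm N f = sqrt (l2_inner N f f)"

(* V t \<omega> is a random field on the probability space M with parameter t in N. If V is jointly
   measurable and the mean of its squared L2 norm is finite, then so is each mean square error
   below, since a finite sum of maps f \<mapsto> l2_inner N f p * p with p in L2 is bounded on L2. *)
definition avg_error ::
    "'a measure \<Rightarrow> 'b measure \<Rightarrow> ('b \<Rightarrow> 'a \<Rightarrow> real) \<Rightarrow> nat \<Rightarrow> real" where
  "avg_error M N V n =
     (if n = 0 then sqrt (\<integral>\<omega>. (l2_norm N (\<lambda>t. V t \<omega>))\<^sup>2 \<partial>M)
      else (INF \<psi>\<in>{1..n} \<rightarrow> L2 N.
              sqrt (\<integral>\<omega>. (l2_norm N (\<lambda>t. V t \<omega> -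
                (\<Sum>m=1..n. l2_inner N (\<lambda>s. V s \<omega>) (\<psi> m) * \<psi> m t)))\<^sup>2 \<partial>M)))"

definition avg_complexity ::
    "'a measure \<Rightarrow> 'b measure \<Rightarrow> ('b \<Rightarrow> 'a \<Rightarrow> real) \<Rightarrow> real \<Rightarrow> nat" where
  "avg_complexity M N V \<epsilon> =
     (LEAST n. n \<ge> 1 \<and> avg_error M N V n \<le> \<epsilon> * avg_error M N V 0)"

definition Y :: "(nat \<Rightarrow> real \<Rightarrow> 'a \<Rightarrow> real) \<Rightarrow> nat \<Rightarrow> (nat \<Rightarrow> real) \<Rightarrow> 'a \<Rightarrow> real" where
  "Y X d t \<omega> = (\<Sum>j=1..d. X j (t j) \<omega>)"

definition Z :: "(nat \<Rightarrow> real \<Rightarrow> 'a \<Rightarrow> real) \<Rightarrow> nat \<Rightarrow> (nat \<Rightarrow> real) \<Rightarrow> 'a \<Rightarrow> real" where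
  "Z X d t \<omega> = Y X d t \<omega> - (\<integral>s. Y X d s \<omega> \<partial>cube d)"

definition Lambda :: "(real \<Rightarrow> real \<Rightarrow> real) \<Rightarrow> real" where
  "Lambda K = (\<integral>s. K s s \<partial>unit_leb)"

definition lambda0_bar :: "(real \<Rightarrow> real \<Rightarrow> real) \<Rightarrow> real" where
  "lambda0_bar K = (\<integral>t. (\<integral>s. K t s \<partial>unit_leb) \<partial>unit_leb)"

definition Lambda_bar :: "(real \<Rightarrow> real \<Rightarrow> real) \<Rightarrow> real" where
  "Lambda_bar K = Lambda K - lambda0_bar K"

definition eps0 :: "(real \<Rightarrow> real \<Rightarrow> real) \<Rightarrow> real" where
  "eps0 K = sqrt (Lambda_bar K / Lambda K)"

end

theory Submission
  imports Defs
begin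

text \<open>
  \<open>Y X d\<close> and \<open>Z X d\<close> differ by a random multiple of the constant function \<open>1\<close>. By
  orthonormalization, approximating with \<open>n\<close> functions \<open>\<psi>\<close> and arbitrary random coefficients is
  never better than the average error for \<open>n\<close>, so adding the function \<open>1\<close> to an approximating
  family for one field gives one for the other, with the same error: the \<open>(n + 1)\<close>-st error of
  each field is at most the \<open>n\<close>-th error of the other. The \<open>0\<close>-th errors are
  \<open>sqrt (d * Lambda K)\<close> and \<open>sqrt (d * Lambda_bar K)\<close>, so \<open>eps0 K\<close> converts one normalization
  into the other.
  The minimum defining the complexity of \<open>Y X d\<close> exists because its mean square modulus of
  continuity is controlled by \<open>K\<close>, so that step functions approximate it.
\<close>

section \<open>Square-integrable functions\<close>

lemma L2_integrable_mult:
  assumes "f \<in> L2 N" "g \<in> L2 N"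
  shows "integrable N (\<lambda>x. f x * g x)"
proof (rule Bochner_Integration.integrable_bound[where f = "\<lambda>x. (f x)\<^sup>2 + (g x)\<^sup>2"])
  show "integrable N (\<lambda>x. (f x)\<^sup>2 + (g x)\<^sup>2)"
    using assms by (simp add: L2_def)
  show "(\<lambda>x. f x * g x) \<in> borel_measurable N"
    using assms by (auto simp: L2_def)
  have "\<bar>f x * g x\<bar> \<le> (f x)\<^sup>2 + (g x)\<^sup>2" for x
  proof -
    have "0 \<le> (\<bar>f x\<bar> - \<bar>g x\<bar>)\<^sup>2" "0 \<le> (f x)\<^sup>2 + (g x)\<^sup>2"
      by simp_all
    then show ?thesis
      unfolding power2_diff power2_abs abs_mult
      using mult_nonneg_nonneg[OF abs_ge_zero[of "f x"] abs_ge_zero[of "g x"]] by linarith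
  qed
  then show "AE x in N. norm (f x * g x) \<le> norm ((f x)\<^sup>2 + (g x)\<^sup>2)"
    by simp
qed

lemma L2_scale: "f \<in> L2 N \<Longrightarrow> (\<lambda>x. a * f x) \<in> L2 N"
  by (auto simp: L2_def power_mult_distrib)

lemma L2_add:
  assumes "f \<in> L2 N" "g \<in> L2 N"
  shows "(\<lambda>x. f x + g x) \<in> L2 N"
  using assms L2_integrable_mult[OF assms] by (auto simp: L2_def power2_sum mult.assoc)

lemma L2_diff: "f \<in> L2 N \<Longrightarrow> g \<in> L2 N \<Longrightarrow> (\<lambda>x. f x - g x) \<in> L2 N"
  using L2_add[of f N "\<lambda>x. - 1 * g x"] L2_scale[of g N "- 1"] by simp

lemma L2_sum: "(\<And>i. i \<in> I \<Longrightarrow> f i \<in> L2 N) \<Longrightarrow> (\<lambda>x. \<Sum>i\<in>I. f i x) \<in> L2 N"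
proof (induction I rule: infinite_finite_induct)
  case (insert i I)
  then show ?case
    by (auto intro: L2_add)
qed (simp_all add: L2_def)

lemma (in finite_measure) L2_const: "(\<lambda>_. c) \<in> L2 M"
  by (simp add: L2_def)

lemma l2_inner_commute: "l2_inner N f g = l2_inner N g f"
  by (simp add: l2_inner_def mult.commute)

lemma l2_inner_nonneg: "0 \<le> l2_inner N f f"
  by (simp add: l2_inner_def)

lemma l2_norm_square: "(l2_norm N f)\<^sup>2 = l2_inner N f f"
  by (simp add: l2_norm_def l2_inner_nonneg)

lemma l2_inner_scale: "l2_inner N (\<lambda>x. a * f x) g = a * l2_inner N f g"
  by (simp add: l2_inner_def mult.assoc)

lemma l2_inner_add:
  assumes "f \<in> L2 N" "g \<in> L2 N" "h \<in> L2 N"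
  shows "l2_inner N (\<lambda>x. f x + g x) h = l2_inner N f h + l2_inner N g h"
  using assms by (simp add: l2_inner_def L2_integrable_mult distrib_right)

lemma l2_inner_diff:
  assumes "f \<in> L2 N" "g \<in> L2 N" "h \<in> L2 N"
  shows "l2_inner N (\<lambda>x. f x - g x) h = l2_inner N f h - l2_inner N g h"
  using assms by (simp add: l2_inner_def L2_integrable_mult left_diff_distrib)

lemma l2_inner_sum:
  assumes "\<And>i. i \<in> I \<Longrightarrow> f i \<in> L2 N" "h \<in> L2 N"
  shows "l2_inner N (\<lambda>x. \<Sum>i\<in>I. f i x) h = (\<Sum>i\<in>I. l2_inner N (f i) h)"
  using assms by (simp add: l2_inner_def L2_integrable_mult sum_distrib_right)

text \<open>Elements of \<open>L2 N\<close> are functions, so norm zero only means vanishing almost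
  everywhere, and inner products do not see the difference. This settles the degenerate cases of
  Cauchy-Schwarz and of the orthonormalization.\<close>

lemma l2_inner_eq_0:
  assumes "f \<in> L2 N" "g \<in> L2 N" "l2_inner N g g = 0"
  shows "l2_inner N f g = 0"
proof -
  have "AE x in N. g x * g x = 0"
    using assms integral_nonneg_eq_0_iff_AE[of N "\<lambda>x. g x * g x"]
    by (simp add: l2_inner_def L2_integrable_mult)
  then have "AE x in N. f x * g x = 0"
    by eventually_elim simp
  then show ?thesis
    by (simp add: l2_inner_def integral_eq_zero_AE)
qed

lemma l2_Cauchy_Schwarz:
  assumes "f \<in> L2 N" "g \<in> L2 N"
  shows "(l2_inner N f g)\<^sup>2 \<le> l2_inner N f f * l2_inner N g g"
proof (cases "l2_inner N g g = 0")
  case True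
  then show ?thesis
    using assms by (simp add: l2_inner_eq_0)
next
  case False
  \<comment> \<open>\<open>a * g\<close> is the orthogonal projection of \<open>f\<close> onto the
    line through \<open>g\<close>; the inequality says that the squared norm of the remainder is
    nonnegative.\<close>
  define a where "a = l2_inner N f g / l2_inner N g g"
  have ag: "(\<lambda>x. a * g x) \<in> L2 N"
    using assms by (simp add: L2_scale)
  have d: "(\<lambda>x. f x - a * g x) \<in> L2 N"
    by (rule L2_diff[OF assms(1) ag])
  have pos: "l2_inner N g g > 0"
    using False l2_inner_nonneg[of N g] by simp
  have "0 \<le> l2_inner N (\<lambda>x. f x - a * g x) (\<lambda>x. f x - a * g x)"
    by (rule l2_inner_nonneg)
  also have "\<dots> = l2_inner N (\<lambda>x. f x - a * g x) f - a * l2_inner N (\<lambda>x. f x - a * g x) g"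
    using l2_inner_diff[OF assms(1) ag d] l2_inner_scale[of N a g] by (metis l2_inner_commute)
  also have "\<dots> = l2_inner N f f - (l2_inner N f g)\<^sup>2 / l2_inner N g g"
    using pos l2_inner_diff[OF assms(1) ag assms(1)] l2_inner_diff[OF assms(1) ag assms(2)]
    unfolding l2_inner_scale by (simp add: l2_inner_commute[of N g f] a_def power2_eq_square)
  finally show ?thesis
    using pos by (simp add: field_simps)
qed

section \<open>Orthonormalization and best approximation\<close>

text \<open>The error expression inside \<open>avg_error\<close>, for an arbitrary family. It is the
  residual of a projection when, say, the members of the family are orthonormal or zero.\<close>

definition l2_residual :: "'b measure \<Rightarrow> nat \<Rightarrow> (nat \<Rightarrow> 'b \<Rightarrow> real) \<Rightarrow> ('b \<Rightarrow> real) \<Rightarrow> 'b \<Rightarrow> real" where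
  "l2_residual N n \<phi> f = (\<lambda>x. f x - (\<Sum>m=1..n. l2_inner N f (\<phi> m) * \<phi> m x))"

lemma L2_residual:
  assumes "\<phi> \<in> {1..n} \<rightarrow> L2 N" "f \<in> L2 N"
  shows "l2_residual N n \<phi> f \<in> L2 N"
  unfolding l2_residual_def using assms
  by (intro L2_diff L2_sum L2_scale) auto

lemma l2_inner_residual:
  assumes "\<phi> \<in> {1..n} \<rightarrow> L2 N" "f \<in> L2 N" "g \<in> L2 N"
  shows "l2_inner N (l2_residual N n \<phi> f) g
    = l2_inner N f g - (\<Sum>m=1..n. l2_inner N f (\<phi> m) * l2_inner N (\<phi> m) g)"
proof -
  have *: "(\<lambda>x. l2_inner N f (\<phi> m) * \<phi> m x) \<in> L2 N" if "m \<in> {1..n}" for m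
    using assms that by (intro L2_scale) auto
  have "l2_inner N (l2_residual N n \<phi> f) g
    = l2_inner N f g - l2_inner N (\<lambda>x. \<Sum>m=1..n. l2_inner N f (\<phi> m) * \<phi> m x) g"
    unfolding l2_residual_def by (rule l2_inner_diff) (use assms * in \<open>auto intro: L2_sum\<close>)
  also have "l2_inner N (\<lambda>x. \<Sum>m=1..n. l2_inner N f (\<phi> m) * \<phi> m x) g
    = (\<Sum>m=1..n. l2_inner N f (\<phi> m) * l2_inner N (\<phi> m) g)"
    by (subst l2_inner_sum) (use assms * in \<open>auto simp: l2_inner_scale\<close>)
  finally show ?thesis .
qed

text \<open>Some \<open>\<phi> m\<close> may vanish, so the family need not be linearly independent and no rank has to be
  computed.\<close>

lemma gram_schmidt:
  assumes "finite I" "\<And>i. i \<in> I \<Longrightarrow> \<psi> i \<in> L2 N"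
  shows "\<exists>\<phi> \<in> {1..card I} \<rightarrow> L2 N. \<forall>f \<in> L2 N.
    (\<forall>m\<in>{1..card I}. l2_inner N (l2_residual N (card I) \<phi> f) (\<phi> m) = 0) \<and>
    (\<forall>i\<in>I. l2_inner N (l2_residual N (card I) \<phi> f) (\<psi> i) = 0)"
  using assms
proof (induction I rule: finite_induct)
  case empty
  then show ?case by auto
next
  case (insert i I)
  define n where "n = card I"
  have card: "card (insert i I) = Suc n"
    using insert by (simp add: n_def)
  obtain \<phi> where \<phi>: "\<phi> \<in> {1..n} \<rightarrow> L2 N"
    and orth: "\<And>f m. f \<in> L2 N \<Longrightarrow> m \<in> {1..n} \<Longrightarrow> l2_inner N (l2_residual N n \<phi> f) (\<phi> m) = 0"
      "\<And>f k. f \<in> L2 N \<Longrightarrow> k \<in> I \<Longrightarrow> l2_inner N (l2_residual N n \<phi> f) (\<psi> k) = 0"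
    using insert unfolding n_def by (metis insertCI)
  have \<psi>i: "\<psi> i \<in> L2 N"
    using insert by simp
  define r where "r = l2_residual N n \<phi> (\<psi> i)"
  \<comment> \<open>If \<open>r\<close> has norm zero, division by zero gives \<open>a = 0\<close>
    and the new member \<open>e\<close> is the zero function; otherwise \<open>e\<close> has norm
    one.\<close>
  define a where "a = 1 / l2_norm N r"
  define e where "e = (\<lambda>x. a * r x)"
  define \<phi>' where "\<phi>' = \<phi>(Suc n := e)"
  have r: "r \<in> L2 N"
    unfolding r_def by (rule L2_residual[OF \<phi> \<psi>i])
  have e: "e \<in> L2 N"
    unfolding e_def by (rule L2_scale[OF r])
  have \<phi>': "\<phi>' \<in> {1..Suc n} \<rightarrow> L2 N"
    using \<phi> e by (auto simp: \<phi>'_def Pi_iff le_Suc_eq)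
  have orth_e: "l2_inner N e (\<phi> m) = 0" if "m \<in> {1..n}" for m
    unfolding e_def l2_inner_scale r_def using orth(1)[OF \<psi>i that] by simp
  have orth_e': "l2_inner N e (\<psi> k) = 0" if "k \<in> I" for k
    unfolding e_def l2_inner_scale r_def using orth(2)[OF \<psi>i that] by simp
  have "(\<forall>m\<in>{1..Suc n}. l2_inner N (l2_residual N (Suc n) \<phi>' f) (\<phi>' m) = 0) \<and>
      (\<forall>k\<in>insert i I. l2_inner N (l2_residual N (Suc n) \<phi>' f) (\<psi> k) = 0)"
    if f: "f \<in> L2 N" for f
  proof -
    define s where "s = l2_residual N n \<phi> f"
    define s' where "s' = l2_residual N (Suc n) \<phi>' f"
    have s: "s \<in> L2 N"
      unfolding s_def by (rule L2_residual[OF \<phi> f])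
    have s': "s' \<in> L2 N"
      unfolding s'_def by (rule L2_residual[OF \<phi>' f])
    have s'_eq: "s' = (\<lambda>x. s x - l2_inner N f e * e x)"
    proof -
      have "(\<Sum>m=1..n. l2_inner N f (\<phi>' m) * \<phi>' m x) = (\<Sum>m=1..n. l2_inner N f (\<phi> m) * \<phi> m x)" for x
        by (rule sum.cong) (auto simp: \<phi>'_def)
      then show ?thesis
        by (simp add: s'_def s_def l2_residual_def \<phi>'_def fun_eq_iff)
    qed
    have inner_s': "l2_inner N s' g = l2_inner N s g - l2_inner N f e * l2_inner N e g"
      if "g \<in> L2 N" for g
      unfolding s'_eq using l2_inner_diff[OF s L2_scale[OF e] that] by (simp add: l2_inner_scale)
    have orth_\<phi>: "l2_inner N s' (\<phi> m) = 0" if "m \<in> {1..n}" for m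
      using inner_s'[of "\<phi> m"] orth(1)[OF f that] orth_e[OF that] \<phi> that
      by (auto simp: s_def Pi_iff)
    \<comment> \<open>\<open>s\<close> differs from \<open>f\<close> by a combination of the
      \<open>\<phi> m\<close>, all orthogonal to \<open>e\<close>, so both have the same coefficient
      along \<open>e\<close>.\<close>
    have "l2_inner N s e = l2_inner N f e"
      unfolding s_def l2_inner_residual[OF \<phi> f e]
      by (auto intro!: sum.neutral simp: l2_inner_commute[of N _ e] orth_e)
    then have s'e: "l2_inner N s' e = l2_inner N f e * (1 - l2_inner N e e)"
      using inner_s'[OF e] by (simp add: algebra_simps)
    have ee: "l2_inner N e e = a * a * l2_inner N r r"
      unfolding e_def l2_inner_scale by (subst l2_inner_commute) (simp add: l2_inner_scale)
    have orth_s'e: "l2_inner N s' e = 0" and orth_s'r: "l2_inner N s' r = 0"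
    proof -
      \<comment> \<open>If \<open>r\<close> has norm zero, so has \<open>e\<close>, and both are
        orthogonal to everything. Otherwise \<open>l2_inner N e e = 1\<close> makes the last factor
        in \<open>s'e\<close> vanish, and \<open>e\<close> is a nonzero multiple of
        \<open>r\<close>.\<close>
      consider "l2_inner N r r = 0" | "l2_inner N r r > 0"
        using l2_inner_nonneg[of N r] by linarith
      then have "l2_inner N s' e = 0 \<and> l2_inner N s' r = 0"
      proof cases
        case 1
        then show ?thesis
          using l2_inner_eq_0[OF s' r] l2_inner_eq_0[OF s' e] ee by simp
      next
        case 2
        then have "a * a * l2_inner N r r = 1" "a \<noteq> 0"
          by (simp_all add: a_def l2_norm_def)
        then have "l2_inner N s' e = 0"
          using s'e ee by simp
        moreover have "l2_inner N s' e = a * l2_inner N s' r"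
          unfolding e_def by (metis l2_inner_commute l2_inner_scale)
        ultimately show ?thesis
          using \<open>a \<noteq> 0\<close> by simp
      qed
      then show "l2_inner N s' e = 0" "l2_inner N s' r = 0"
        by auto
    qed
    \<comment> \<open>\<open>\<psi> i\<close> differs from \<open>r\<close> by a combination of the
      \<open>\<phi> m\<close>, to which \<open>s'\<close> is orthogonal.\<close>
    have "l2_inner N s' (\<psi> i) = 0"
    proof -
      have "l2_inner N r s' = l2_inner N (\<psi> i) s'"
        unfolding r_def l2_inner_residual[OF \<phi> \<psi>i s']
        by (auto intro!: sum.neutral simp: l2_inner_commute[of N _ s'] orth_\<phi>)
      then show ?thesis
        using orth_s'r by (simp add: l2_inner_commute)
    qed
    moreover have "l2_inner N s' (\<psi> k) = 0" if "k \<in> I" for k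
      using inner_s'[of "\<psi> k"] orth(2)[OF f that] orth_e'[OF that] insert.prems that
      by (auto simp: s_def)
    moreover have "l2_inner N s' (\<phi>' m) = 0" if "m \<in> {1..Suc n}" for m
      using that orth_\<phi> orth_s'e by (auto simp: \<phi>'_def le_Suc_eq)
    ultimately show ?thesis
      by (auto simp: s'_def)
  qed
  then show ?case
    unfolding card using \<phi>' by blast
qed

text \<open>Pythagoras: any competitor leaves the residual plus a combination of the
  \<open>\<phi> m\<close> and \<open>\<psi> i\<close>, and the residual is orthogonal to both
  families. One \<open>\<phi>\<close> serves all \<open>f\<close> and \<open>c\<close>, so that both
  may later depend on \<open>\<omega>\<close>.\<close>

lemma l2_best_approximation:
  assumes "finite I" "\<And>i. i \<in> I \<Longrightarrow> \<psi> i \<in> L2 N"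
  shows "\<exists>\<phi> \<in> {1..card I} \<rightarrow> L2 N. \<forall>f \<in> L2 N. \<forall>c. l2_norm N (l2_residual N (card I) \<phi> f)
    \<le> l2_norm N (\<lambda>x. f x - (\<Sum>i\<in>I. c i * \<psi> i x))"
proof -
  let ?n = "card I"
  obtain \<phi> where \<phi>: "\<phi> \<in> {1..?n} \<rightarrow> L2 N"
    and orth: "\<And>f m. f \<in> L2 N \<Longrightarrow> m \<in> {1..?n} \<Longrightarrow> l2_inner N (l2_residual N ?n \<phi> f) (\<phi> m) = 0"
      "\<And>f i. f \<in> L2 N \<Longrightarrow> i \<in> I \<Longrightarrow> l2_inner N (l2_residual N ?n \<phi> f) (\<psi> i) = 0"
    using gram_schmidt[of I \<psi> N, OF assms] by blast
  have "l2_norm N (l2_residual N ?n \<phi> f) \<le> l2_norm N (\<lambda>x. f x - (\<Sum>i\<in>I. c i * \<psi> i x))"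
    if f: "f \<in> L2 N" for f c
  proof -
    define r where "r = l2_residual N ?n \<phi> f"
    define g where "g = (\<lambda>x. f x - (\<Sum>i\<in>I. c i * \<psi> i x))"
    define p where "p = (\<lambda>x. \<Sum>m=1..?n. l2_inner N f (\<phi> m) * \<phi> m x)"
    define q where "q = (\<lambda>x. \<Sum>i\<in>I. c i * \<psi> i x)"
    define h where "h = (\<lambda>x. p x - q x)"
    have r: "r \<in> L2 N"
      unfolding r_def by (rule L2_residual[OF \<phi> f])
    have p: "p \<in> L2 N"
      unfolding p_def using \<phi> by (intro L2_sum L2_scale) auto
    have q: "q \<in> L2 N"
      unfolding q_def using assms by (intro L2_sum L2_scale) auto
    have h: "h \<in> L2 N"
      unfolding h_def by (rule L2_diff[OF p q])
    have g_eq: "g = (\<lambda>x. r x + h x)"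
      by (simp add: g_def r_def h_def p_def q_def l2_residual_def)
    have orth_r: "l2_inner N (\<phi> m) r = 0" if "m \<in> {1..?n}" for m
      using orth(1)[OF f that] by (simp add: r_def l2_inner_commute)
    have orth_r': "l2_inner N (\<psi> i) r = 0" if "i \<in> I" for i
      using orth(2)[OF f that] by (simp add: r_def l2_inner_commute)
    have "l2_inner N p r = 0"
      unfolding p_def using \<phi> orth_r r
      by (subst l2_inner_sum) (auto intro!: L2_scale sum.neutral simp: l2_inner_scale)
    moreover have "l2_inner N q r = 0"
      unfolding q_def using assms orth_r' r
      by (subst l2_inner_sum) (auto intro!: L2_scale sum.neutral simp: l2_inner_scale)
    ultimately have hr: "l2_inner N h r = 0"
      unfolding h_def using l2_inner_diff[OF p q r] by simp
    have "l2_inner N g g = l2_inner N r g + l2_inner N h g"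
      unfolding g_eq by (rule l2_inner_add[OF r h L2_add[OF r h]])
    also have "\<dots> = l2_inner N r r + l2_inner N h h"
      using l2_inner_add[OF r h r] l2_inner_add[OF r h h] hr
      unfolding g_eq[symmetric] by (simp add: l2_inner_commute)
    finally have "l2_inner N r r \<le> l2_inner N g g"
      using l2_inner_nonneg[of N h] by simp
    then show ?thesis
      unfolding r_def g_def by (simp add: l2_norm_def)
  qed
  then show ?thesis
    by (intro bexI[of _ \<phi>] ballI allI \<phi>)
qed

section \<open>Average errors of random fields\<close>

context pair_prob_space
begin

lemma L2_section:
  assumes "case_prod V \<in> L2 (M1 \<Otimes>\<^sub>M M2)"
  shows "AE \<omega> in M2. (\<lambda>t. V t \<omega>) \<in> L2 M1"
proof -
  have [measurable]: "case_prod V \<in> borel_measurable (M1 \<Otimes>\<^sub>M M2)"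
    using assms by (simp add: L2_def)
  have "integrable (M1 \<Otimes>\<^sub>M M2) (\<lambda>(t, \<omega>). (V t \<omega>)\<^sup>2)"
    using assms by (simp add: L2_def case_prod_beta')
  then have "AE \<omega> in M2. integrable M1 (\<lambda>t. (V t \<omega>)\<^sup>2)"
    by (rule AE_integrable_snd)
  with AE_space show ?thesis
    by eventually_elim (simp add: L2_def)
qed

text \<open>By Fubini, mean square norms reduce to pointwise second moments, which the covariance
  determines.\<close>

lemma integrable_l2_norm_section:
  assumes "case_prod V \<in> L2 (M1 \<Otimes>\<^sub>M M2)"
  shows "integrable M2 (\<lambda>\<omega>. (l2_norm M1 (\<lambda>t. V t \<omega>))\<^sup>2)"
    and "(\<integral>\<omega>. (l2_norm M1 (\<lambda>t. V t \<omega>))\<^sup>2 \<partial>M2) = (\<integral>t. (\<integral>\<omega>. (V t \<omega>)\<^sup>2 \<partial>M2) \<partial>M1)"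
    and "integrable M1 (\<lambda>t. \<integral>\<omega>. (V t \<omega>)\<^sup>2 \<partial>M2)"
proof -
  have *: "integrable (M1 \<Otimes>\<^sub>M M2) (\<lambda>(t, \<omega>). (V t \<omega>)\<^sup>2)"
    using assms by (simp add: L2_def case_prod_beta')
  show "integrable M2 (\<lambda>\<omega>. (l2_norm M1 (\<lambda>t. V t \<omega>))\<^sup>2)"
    using integrable_snd[OF *] by (simp add: l2_norm_square l2_inner_def flip: power2_eq_square)
  show "(\<integral>\<omega>. (l2_norm M1 (\<lambda>t. V t \<omega>))\<^sup>2 \<partial>M2) = (\<integral>t. (\<integral>\<omega>. (V t \<omega>)\<^sup>2 \<partial>M2) \<partial>M1)"
    using Fubini_integral[OF *] by (simp add: l2_norm_square l2_inner_def flip: power2_eq_square)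
  show "integrable M1 (\<lambda>t. \<integral>\<omega>. (V t \<omega>)\<^sup>2 \<partial>M2)"
    by (rule integrable_fst[OF *])
qed

text \<open>Cauchy-Schwarz on almost every path bounds the squared coefficient by a constant times
  the squared norm of the path. Approximation errors with such coefficients then fall under
  \<open>L2_diff_tensor_sum\<close>.\<close>

lemma L2_inner_section:
  assumes V: "case_prod V \<in> L2 (M1 \<Otimes>\<^sub>M M2)" and \<psi>: "\<psi> \<in> L2 M1"
  shows "(\<lambda>\<omega>. l2_inner M1 (\<lambda>t. V t \<omega>) \<psi>) \<in> L2 M2"
proof -
  have [measurable]: "case_prod V \<in> borel_measurable (M1 \<Otimes>\<^sub>M M2)" "\<psi> \<in> borel_measurable M1"
    using assms by (simp_all add: L2_def)
  have m [measurable]: "(\<lambda>\<omega>. l2_inner M1 (\<lambda>t. V t \<omega>) \<psi>) \<in> borel_measurable M2"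
    unfolding l2_inner_def by measurable
  have "integrable M2 (\<lambda>\<omega>. (l2_inner M1 (\<lambda>t. V t \<omega>) \<psi>)\<^sup>2)"
  proof (rule Bochner_Integration.integrable_bound)
    show "integrable M2 (\<lambda>\<omega>. (l2_norm M1 (\<lambda>t. V t \<omega>))\<^sup>2 * l2_inner M1 \<psi> \<psi>)"
      using integrable_l2_norm_section(1)[OF V] by simp
    show "AE \<omega> in M2. norm ((l2_inner M1 (\<lambda>t. V t \<omega>) \<psi>)\<^sup>2)
      \<le> norm ((l2_norm M1 (\<lambda>t. V t \<omega>))\<^sup>2 * l2_inner M1 \<psi> \<psi>)"
      using L2_section[OF V]
      by eventually_elim
        (use l2_Cauchy_Schwarz[OF _ \<psi>] in \<open>simp add: l2_norm_square l2_inner_nonneg\<close>)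
  qed measurable
  with m show ?thesis
    by (simp add: L2_def)
qed

lemma L2_tensor:
  assumes "f \<in> L2 M1" "g \<in> L2 M2"
  shows "(\<lambda>p. g (snd p) * f (fst p)) \<in> L2 (M1 \<Otimes>\<^sub>M M2)"
proof -
  have [measurable]: "f \<in> borel_measurable M1" "g \<in> borel_measurable M2"
    using assms by (simp_all add: L2_def)
  have "integrable (M1 \<Otimes>\<^sub>M M2) (\<lambda>p. (g (snd p) * f (fst p))\<^sup>2)"
  proof (rule Fubini_integrable)
    show "integrable M1 (\<lambda>x. \<integral>y. norm ((g (snd (x, y)) * f (fst (x, y)))\<^sup>2) \<partial>M2)"
      using assms by (simp add: power_mult_distrib L2_def)
    show "AE x in M1. integrable M2 (\<lambda>y. (g (snd (x, y)) * f (fst (x, y)))\<^sup>2)"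
      using assms by (simp add: power_mult_distrib L2_def)
  qed measurable
  then show ?thesis
    by (simp add: L2_def)
qed

lemma L2_diff_tensor_sum:
  assumes V: "case_prod V \<in> L2 (M1 \<Otimes>\<^sub>M M2)"
    and "\<And>i. i \<in> I \<Longrightarrow> \<psi> i \<in> L2 M1" "\<And>i. i \<in> I \<Longrightarrow> c i \<in> L2 M2"
  shows "case_prod (\<lambda>t \<omega>. V t \<omega> - (\<Sum>i\<in>I. c i \<omega> * \<psi> i t)) \<in> L2 (M1 \<Otimes>\<^sub>M M2)"
  unfolding case_prod_beta'
  using V assms(2,3) by (intro L2_diff L2_sum L2_tensor) (simp_all add: case_prod_beta')

text \<open>The family from \<open>l2_best_approximation\<close> does not depend on
  \<open>\<omega>\<close>, yet on almost every path it does at least as well as the coefficients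
  \<open>c i \<omega>\<close>. Stating the bound through an integrable majorant \<open>U\<close>
  leaves \<open>c\<close> free of any measurability condition.\<close>

lemma avg_error_le:
  assumes V: "AE \<omega> in M2. (\<lambda>t. V t \<omega>) \<in> L2 M1"
    and I: "finite I" "\<And>i. i \<in> I \<Longrightarrow> \<psi> i \<in> L2 M1"
    and U: "integrable M2 U"
      "AE \<omega> in M2. (l2_norm M1 (\<lambda>t. V t \<omega> - (\<Sum>i\<in>I. c i \<omega> * \<psi> i t)))\<^sup>2 \<le> U \<omega>"
  shows "avg_error M2 M1 V (card I) \<le> sqrt (\<integral>\<omega>. U \<omega> \<partial>M2)"
proof -
  obtain \<phi> where \<phi>: "\<phi> \<in> {1..card I} \<rightarrow> L2 M1"
    and best: "\<forall>f \<in> L2 M1. \<forall>c. l2_norm M1 (l2_residual M1 (card I) \<phi> f)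
      \<le> l2_norm M1 (\<lambda>x. f x - (\<Sum>i\<in>I. c i * \<psi> i x))"
    by (rule bexE[OF l2_best_approximation[of I \<psi> M1, OF I]])
  have "AE \<omega> in M2. (l2_norm M1 (l2_residual M1 (card I) \<phi> (\<lambda>t. V t \<omega>)))\<^sup>2 \<le> U \<omega>"
    using V U(2)
  proof eventually_elim
    case (elim \<omega>)
    have "0 \<le> l2_norm M1 (l2_residual M1 (card I) \<phi> (\<lambda>t. V t \<omega>))"
      by (simp add: l2_norm_def l2_inner_nonneg)
    then have "(l2_norm M1 (l2_residual M1 (card I) \<phi> (\<lambda>t. V t \<omega>)))\<^sup>2
        \<le> (l2_norm M1 (\<lambda>t. V t \<omega> - (\<Sum>i\<in>I. c i \<omega> * \<psi> i t)))\<^sup>2"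
      using best[rule_format, OF elim(1), of "\<lambda>i. c i \<omega>"] by (rule power_mono[rotated])
    then show ?case
      using elim(2) by (rule order_trans)
  qed
  \<comment> \<open>The squared norm of the residual is not known to be integrable here. Its Bochner
    integral would be zero if it were not, and the comparison then rests on \<open>U\<close> being
    nonnegative.\<close>
  moreover from U(2) have "AE \<omega> in M2. 0 \<le> U \<omega>"
    by eventually_elim (rule order_trans[OF zero_le_power2])
  ultimately have le: "(\<integral>\<omega>. (l2_norm M1 (l2_residual M1 (card I) \<phi> (\<lambda>t. V t \<omega>)))\<^sup>2 \<partial>M2)
      \<le> (\<integral>\<omega>. U \<omega> \<partial>M2)"
    by (rule integral_mono_AE'[OF U(1)])
  show ?thesis
  \<comment> \<open>\<open>avg_error\<close> has a separate clause at index zero: no infimum is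
    taken and the residual is \<open>V\<close> itself.\<close>
  proof (cases "card I = 0")
    case True
    then show ?thesis
      using le by (simp add: avg_error_def l2_residual_def)
  next
    case False
    have "avg_error M2 M1 V (card I)
      \<le> sqrt (\<integral>\<omega>. (l2_norm M1 (l2_residual M1 (card I) \<phi> (\<lambda>t. V t \<omega>)))\<^sup>2 \<partial>M2)"
      unfolding avg_error_def l2_residual_def if_not_P[OF False]
      by (rule cINF_lower[OF bdd_belowI2[where m = 0] \<phi>]) simp
    also have "\<dots> \<le> sqrt (\<integral>\<omega>. U \<omega> \<partial>M2)"
      using le by (rule real_sqrt_le_mono)
    finally show ?thesis .
  qed
qed

text \<open>One additional function, the constant \<open>1\<close>, absorbs any random shift.\<close>

lemma avg_error_shift:
  assumes V: "case_prod V \<in> L2 (M1 \<Otimes>\<^sub>M M2)" and "n \<ge> 1"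
  shows "avg_error M2 M1 (\<lambda>t \<omega>. V t \<omega> + S \<omega>) (Suc n) \<le> avg_error M2 M1 V n"
proof -
  have "avg_error M2 M1 (\<lambda>t \<omega>. V t \<omega> + S \<omega>) (Suc n)
      \<le> sqrt (\<integral>\<omega>. (l2_norm M1 (\<lambda>t. V t \<omega> -
                (\<Sum>m=1..n. l2_inner M1 (\<lambda>s. V s \<omega>) (\<psi> m) * \<psi> m t)))\<^sup>2 \<partial>M2)"
    if \<psi>: "\<psi> \<in> {1..n} \<rightarrow> L2 M1" for \<psi>
  proof -
    \<comment> \<open>The given family occupies the indices \<open>1..n\<close>, which leaves index
      zero for the constant function; \<open>{0..n}\<close> has \<open>Suc n\<close>
      elements.\<close>
    define \<psi>' where "\<psi>' = \<psi>(0 := \<lambda>_. 1)"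
    define c where "c = (\<lambda>m \<omega>. if m = 0 then S \<omega> else l2_inner M1 (\<lambda>s. V s \<omega>) (\<psi> m))"
    have "(\<Sum>m\<in>{0..n}. c m \<omega> * \<psi>' m t)
      = S \<omega> + (\<Sum>m=1..n. l2_inner M1 (\<lambda>s. V s \<omega>) (\<psi> m) * \<psi> m t)" for \<omega> t
      by (auto simp: sum.atLeast_Suc_atMost[of 0] c_def \<psi>'_def intro!: sum.cong)
    \<comment> \<open>The shift cancels on every path, so the squared error of \<open>V\<close>
      itself serves as the majorant in \<open>avg_error_le\<close>, whatever \<open>S\<close>
      is.\<close>
    then have eq: "(\<lambda>t. V t \<omega> + S \<omega> - (\<Sum>m\<in>{0..n}. c m \<omega> * \<psi>' m t))
      = (\<lambda>t. V t \<omega> - (\<Sum>m=1..n. l2_inner M1 (\<lambda>s. V s \<omega>) (\<psi> m) * \<psi> m t))" for \<omega>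
      by (simp add: fun_eq_iff)
    have "avg_error M2 M1 (\<lambda>t \<omega>. V t \<omega> + S \<omega>) (card {0..n})
      \<le> sqrt (\<integral>\<omega>. (l2_norm M1 (\<lambda>t. V t \<omega> -
                (\<Sum>m=1..n. l2_inner M1 (\<lambda>s. V s \<omega>) (\<psi> m) * \<psi> m t)))\<^sup>2 \<partial>M2)"
    proof (rule avg_error_le)
      show "AE \<omega> in M2. (\<lambda>t. V t \<omega> + S \<omega>) \<in> L2 M1"
        using L2_section[OF V] by eventually_elim (intro L2_add M1.L2_const)
      show "\<psi>' i \<in> L2 M1" if "i \<in> {0..n}" for i
        using \<psi> that by (auto simp: \<psi>'_def M1.L2_const)
      show "integrable M2 (\<lambda>\<omega>. (l2_norm M1 (\<lambda>t. V t \<omega> -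
                (\<Sum>m=1..n. l2_inner M1 (\<lambda>s. V s \<omega>) (\<psi> m) * \<psi> m t)))\<^sup>2)"
        using \<psi> by (intro integrable_l2_norm_section L2_diff_tensor_sum V L2_inner_section) auto
      show "AE \<omega> in M2. (l2_norm M1 (\<lambda>t. V t \<omega> + S \<omega> - (\<Sum>m\<in>{0..n}. c m \<omega> * \<psi>' m t)))\<^sup>2
        \<le> (l2_norm M1 (\<lambda>t. V t \<omega> -
                (\<Sum>m=1..n. l2_inner M1 (\<lambda>s. V s \<omega>) (\<psi> m) * \<psi> m t)))\<^sup>2"
        by (simp add: eq)
    qed simp
    then show ?thesis
      by simp
  qed
  \<comment> \<open>A lower bound for all families passes to the infimum only if there is a family
    at all.\<close>
  moreover have "{1..n} \<rightarrow> L2 M1 \<noteq> {}"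
    using M1.L2_const[of 0] by auto
  ultimately show ?thesis
    using \<open>n \<ge> 1\<close> unfolding avg_error_def[of M2 M1 V n]
    by (auto intro!: cINF_greatest)
qed

text \<open>The square is expanded one factor at a time, with Fubini applied to each: first with the
  whole mean as weight, then with \<open>V t\<close> for fixed \<open>t\<close>.\<close>

lemma integral_square_mean:
  assumes V: "case_prod V \<in> L2 (M1 \<Otimes>\<^sub>M M2)" and Vt: "\<And>t. t \<in> space M1 \<Longrightarrow> V t \<in> L2 M2"
  shows "(\<integral>\<omega>. (\<integral>t. V t \<omega> \<partial>M1)\<^sup>2 \<partial>M2) = (\<integral>t. (\<integral>s. (\<integral>\<omega>. V t \<omega> * V s \<omega> \<partial>M2) \<partial>M1) \<partial>M1)"
proof -
  define S where "S \<omega> = (\<integral>t. V t \<omega> \<partial>M1)" for \<omega>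
  have S: "S \<in> L2 M2"
    using L2_inner_section[OF V M1.L2_const[of 1]] by (simp add: l2_inner_def S_def[abs_def])
  have int: "integrable (M1 \<Otimes>\<^sub>M M2) (\<lambda>(t, \<omega>). g \<omega> * V t \<omega>)" if "g \<in> L2 M2" for g
    using L2_integrable_mult[OF L2_tensor[OF M1.L2_const[of 1] that] V]
    by (simp add: case_prod_beta')
  have "(\<integral>\<omega>. (S \<omega>)\<^sup>2 \<partial>M2) = (\<integral>\<omega>. (\<integral>t. S \<omega> * V t \<omega> \<partial>M1) \<partial>M2)"
    by (simp add: power2_eq_square S_def)
  also have "\<dots> = (\<integral>t. (\<integral>\<omega>. S \<omega> * V t \<omega> \<partial>M2) \<partial>M1)"
    by (rule Fubini_integral[OF int[OF S]])
  also have "\<dots> = (\<integral>t. (\<integral>s. (\<integral>\<omega>. V t \<omega> * V s \<omega> \<partial>M2) \<partial>M1) \<partial>M1)"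
  proof (rule Bochner_Integration.integral_cong[OF refl])
    fix t assume t: "t \<in> space M1"
    have "(\<integral>\<omega>. S \<omega> * V t \<omega> \<partial>M2) = (\<integral>\<omega>. (\<integral>s. V t \<omega> * V s \<omega> \<partial>M1) \<partial>M2)"
      by (simp add: S_def mult.commute)
    also have "\<dots> = (\<integral>s. (\<integral>\<omega>. V t \<omega> * V s \<omega> \<partial>M2) \<partial>M1)"
      by (rule Fubini_integral[OF int[OF Vt[OF t]]])
    finally show "(\<integral>\<omega>. S \<omega> * V t \<omega> \<partial>M2) = (\<integral>s. (\<integral>\<omega>. V t \<omega> * V s \<omega> \<partial>M2) \<partial>M1)" .
  qed
  finally show ?thesis
    by (simp add: S_def)
qed

text \<open>On a probability space the mean is the projection onto the constants, so on almost every
  path centering lowers the squared norm by the square of the mean.\<close>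

lemma integral_l2_norm_centered:
  assumes V: "case_prod V \<in> L2 (M1 \<Otimes>\<^sub>M M2)"
  shows "(\<integral>\<omega>. (l2_norm M1 (\<lambda>t. V t \<omega> - (\<integral>s. V s \<omega> \<partial>M1)))\<^sup>2 \<partial>M2)
    = (\<integral>\<omega>. (l2_norm M1 (\<lambda>t. V t \<omega>))\<^sup>2 \<partial>M2) - (\<integral>\<omega>. (\<integral>t. V t \<omega> \<partial>M1)\<^sup>2 \<partial>M2)"
proof -
  define S where "S \<omega> = (\<integral>t. V t \<omega> \<partial>M1)" for \<omega>
  have S: "S \<in> L2 M2"
    using L2_inner_section[OF V M1.L2_const[of 1]] by (simp add: l2_inner_def S_def[abs_def])
  have V': "case_prod (\<lambda>t \<omega>. V t \<omega> - S \<omega>) \<in> L2 (M1 \<Otimes>\<^sub>M M2)"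
    using L2_diff[OF V L2_tensor[OF M1.L2_const[of 1] S]] by (simp add: case_prod_beta')
  have "AE \<omega> in M2. (l2_norm M1 (\<lambda>t. V t \<omega> - S \<omega>))\<^sup>2 = (l2_norm M1 (\<lambda>t. V t \<omega>))\<^sup>2 - (S \<omega>)\<^sup>2"
    using L2_section[OF V]
  proof eventually_elim
    case (elim \<omega>)
    have i: "integrable M1 (\<lambda>t. V t \<omega> * V t \<omega>)" "integrable M1 (\<lambda>t. V t \<omega>)"
      using L2_integrable_mult[OF elim elim] L2_integrable_mult[OF elim M1.L2_const[of 1]]
      by simp_all
    have "l2_inner M1 (\<lambda>t. V t \<omega> - S \<omega>) (\<lambda>t. V t \<omega> - S \<omega>)
      = (\<integral>t. V t \<omega> * V t \<omega> - (2 * S \<omega>) * V t \<omega> + (S \<omega>)\<^sup>2 \<partial>M1)"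
      unfolding l2_inner_def by (simp add: power2_eq_square algebra_simps)
    also have "\<dots> = l2_inner M1 (\<lambda>t. V t \<omega>) (\<lambda>t. V t \<omega>) - (S \<omega>)\<^sup>2"
      using i by (simp add: S_def[symmetric] l2_inner_def power2_eq_square M1.prob_space)
    finally show ?case
      by (simp add: l2_norm_square)
  qed
  then have "(\<integral>\<omega>. (l2_norm M1 (\<lambda>t. V t \<omega> - S \<omega>))\<^sup>2 \<partial>M2)
    = (\<integral>\<omega>. (l2_norm M1 (\<lambda>t. V t \<omega>))\<^sup>2 - (S \<omega>)\<^sup>2 \<partial>M2)"
    using integrable_l2_norm_section(1)[OF V] integrable_l2_norm_section(1)[OF V'] S
    by (intro integral_cong_AE) (auto simp: L2_def)
  also have "\<dots> = (\<integral>\<omega>. (l2_norm M1 (\<lambda>t. V t \<omega>))\<^sup>2 \<partial>M2) - (\<integral>\<omega>. (S \<omega>)\<^sup>2 \<partial>M2)"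
    using integrable_l2_norm_section(1)[OF V] S by (simp add: L2_def)
  finally show ?thesis
    by (simp add: S_def)
qed

end

section \<open>Complexity as a least index\<close>

lemma avg_complexity_le:
  "n \<ge> 1 \<Longrightarrow> avg_error M N V n \<le> \<epsilon> * avg_error M N V 0 \<Longrightarrow> avg_complexity M N V \<epsilon> \<le> n"
  unfolding avg_complexity_def by (rule Least_le) simp

text \<open>\<open>LEAST\<close> has its defining property only if some index is admissible;
  \<open>n\<close> is the witness.\<close>

lemma avg_complexity_attained:
  assumes "n \<ge> 1" "avg_error M N V n \<le> \<epsilon> * avg_error M N V 0"
  shows "avg_complexity M N V \<epsilon> \<ge> 1"
    and "avg_error M N V (avg_complexity M N V \<epsilon>) \<le> \<epsilon> * avg_error M N V 0"
  using LeastI[of "\<lambda>n. n \<ge> 1 \<and> avg_error M N V n \<le> \<epsilon> * avg_error M N V 0" n] assms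
  unfolding avg_complexity_def by auto

section \<open>Uncorrelated processes with a common continuous covariance\<close>

lemma prob_space_unit_leb: "prob_space unit_leb"
  by (rule prob_space_restrict_space) simp_all

lemma space_unit_leb [simp]: "space unit_leb = {0..1}"
  by (simp add: space_restrict_space)

lemma prob_space_cube: "prob_space (cube d)"
  by (rule prob_space_PiM) (rule prob_space_unit_leb)

lemma cube_coordinate: "t \<in> space (cube d) \<Longrightarrow> j \<in> {1..d} \<Longrightarrow> t j \<in> {0..1}"
  by (auto simp: space_PiM)

lemma measurable_cube_coordinate: "j \<in> {1..d} \<Longrightarrow> (\<lambda>t. t j) \<in> cube d \<rightarrow>\<^sub>M unit_leb"
  by (rule measurable_component_singleton)

text \<open>The marginals of a product of probability measures are its factors, so a single
  coordinate is distributed according to \<open>unit_leb\<close>.\<close>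

lemma
  fixes f :: "real \<Rightarrow> real"
  assumes "f \<in> borel_measurable unit_leb" "j \<in> {1..d}"
  shows integral_cube_coordinate: "(\<integral>t. f (t j) \<partial>cube d) = (\<integral>u. f u \<partial>unit_leb)"
    and integrable_cube_coordinate: "integrable (cube d) (\<lambda>t. f (t j)) \<longleftrightarrow> integrable unit_leb f"
proof -
  have *: "distr (cube d) unit_leb (\<lambda>t. t j) = unit_leb"
    using distr_PiM_component[of "{1..d}" "\<lambda>_. unit_leb" j] prob_space_unit_leb assms by simp
  show "(\<integral>t. f (t j) \<partial>cube d) = (\<integral>u. f u \<partial>unit_leb)"
    using integral_distr[OF measurable_cube_coordinate[OF assms(2)] assms(1)] by (simp only: *)
  show "integrable (cube d) (\<lambda>t. f (t j)) \<longleftrightarrow> integrable unit_leb f"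
    using integrable_distr_eq[OF measurable_cube_coordinate[OF assms(2)] assms(1)] by (simp only: *)
qed

locale uncorrelated_process = prob_space M for M :: "'a measure" +
  fixes X :: "nat \<Rightarrow> real \<Rightarrow> 'a \<Rightarrow> real" and K :: "real \<Rightarrow> real \<Rightarrow> real"
  assumes X_measurable: "j \<ge> 1 \<Longrightarrow> (\<lambda>(t, \<omega>). X j t \<omega>) \<in> borel_measurable (unit_leb \<Otimes>\<^sub>M M)"
    and X_square_integrable: "j \<ge> 1 \<Longrightarrow> t \<in> {0..1} \<Longrightarrow> integrable M (\<lambda>\<omega>. (X j t \<omega>)\<^sup>2)"
    and X_covariance: "j \<ge> 1 \<Longrightarrow> t \<in> {0..1} \<Longrightarrow> s \<in> {0..1} \<Longrightarrow>
      (\<integral>\<omega>. X j t \<omega> * X j s \<omega> \<partial>M) = K t s"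
    and K_continuous: "continuous_on ({0..1} \<times> {0..1}) (\<lambda>(t, s). K t s)"
    and X_uncorrelated: "j \<ge> 1 \<Longrightarrow> k \<ge> 1 \<Longrightarrow> j \<noteq> k \<Longrightarrow> t \<in> {0..1} \<Longrightarrow> s \<in> {0..1} \<Longrightarrow>
      (\<integral>\<omega>. X j t \<omega> * X k s \<omega> \<partial>M) = 0"
begin

section \<open>Regularity of the processes and of their covariance\<close>

lemma X_L2:
  assumes "j \<ge> 1" "t \<in> {0..1}"
  shows "X j t \<in> L2 M"
proof -
  have "X j t \<in> borel_measurable M"
    using measurable_compose[OF measurable_Pair1'[of t unit_leb M] X_measurable[OF assms(1)]] assms
    by simp
  then show ?thesis
    using X_square_integrable[OF assms] by (simp add: L2_def)
qed

text \<open>Writing the covariance as a parameter integral of \<open>X 1\<close> gives measurability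
  for the product sigma-algebra directly.\<close>

lemma K_measurable: "(\<lambda>(t, s). K t s) \<in> borel_measurable (unit_leb \<Otimes>\<^sub>M unit_leb)"
proof -
  have [measurable]: "(\<lambda>(t, \<omega>). X 1 t \<omega>) \<in> borel_measurable (unit_leb \<Otimes>\<^sub>M M)"
    by (rule X_measurable) simp
  have "(\<lambda>(t, s). \<integral>\<omega>. X 1 t \<omega> * X 1 s \<omega> \<partial>M) \<in> borel_measurable (unit_leb \<Otimes>\<^sub>M unit_leb)"
    by measurable
  then show ?thesis
    by (subst measurable_cong[where g = "\<lambda>(t, s). \<integral>\<omega>. X 1 t \<omega> * X 1 s \<omega> \<partial>M"])
      (auto simp: space_pair_measure X_covariance)
qed

lemma K_bounded:
  obtains B where "\<And>t s. t \<in> {0..1} \<Longrightarrow> s \<in> {0..1} \<Longrightarrow> \<bar>K t s\<bar> \<le> B"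
proof -
  have "bounded ((\<lambda>(t, s). K t s) ` ({0..1} \<times> {0..1}))"
    by (intro compact_imp_bounded compact_continuous_image K_continuous compact_Times) simp_all
  then obtain B where "\<And>y. y \<in> (\<lambda>(t, s). K t s) ` ({0..1} \<times> {0..1}) \<Longrightarrow> norm y \<le> B"
    unfolding bounded_iff by blast
  then have "\<bar>K t s\<bar> \<le> B" if "t \<in> {0..1}" "s \<in> {0..1}" for t s
    using that by fastforce
  then show thesis
    by (rule that)
qed

lemma K_section_measurable: "t \<in> {0..1} \<Longrightarrow> K t \<in> borel_measurable unit_leb"
  using measurable_compose[OF measurable_Pair1'[of t unit_leb unit_leb] K_measurable] by simp

lemma K_section_integrable:
  assumes "t \<in> {0..1}"
  shows "integrable unit_leb (K t)"
proof -
  interpret L: prob_space unit_leb by (rule prob_space_unit_leb)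
  obtain B where "\<And>t s. t \<in> {0..1} \<Longrightarrow> s \<in> {0..1} \<Longrightarrow> \<bar>K t s\<bar> \<le> B"
    using K_bounded by blast
  then show ?thesis
    using assms K_section_measurable[OF assms]
    by (intro L.integrable_const_bound[where B = B]) auto
qed

lemma K_diagonal: "(\<lambda>s. K s s) \<in> borel_measurable unit_leb" "integrable unit_leb (\<lambda>s. K s s)"
proof -
  interpret L: prob_space unit_leb by (rule prob_space_unit_leb)
  show m: "(\<lambda>s. K s s) \<in> borel_measurable unit_leb"
    using measurable_compose[OF _ K_measurable, of "\<lambda>s. (s, s)"] by simp
  obtain B where "\<And>t s. t \<in> {0..1} \<Longrightarrow> s \<in> {0..1} \<Longrightarrow> \<bar>K t s\<bar> \<le> B"
    using K_bounded by blast
  with m show "integrable unit_leb (\<lambda>s. K s s)"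
    by (intro L.integrable_const_bound[where B = B]) auto
qed

lemma K_mean: "(\<lambda>t. \<integral>s. K t s \<partial>unit_leb) \<in> borel_measurable unit_leb"
    "integrable unit_leb (\<lambda>t. \<integral>s. K t s \<partial>unit_leb)"
proof -
  interpret L: prob_space unit_leb by (rule prob_space_unit_leb)
  show m: "(\<lambda>t. \<integral>s. K t s \<partial>unit_leb) \<in> borel_measurable unit_leb"
    by (rule L.borel_measurable_lebesgue_integral[OF K_measurable])
  obtain B where B: "\<And>t s. t \<in> {0..1} \<Longrightarrow> s \<in> {0..1} \<Longrightarrow> \<bar>K t s\<bar> \<le> B"
    using K_bounded by blast
  have "\<bar>\<integral>s. K t s \<partial>unit_leb\<bar> \<le> B" if "t \<in> {0..1}" for t
  proof -
    have "\<bar>\<integral>s. K t s \<partial>unit_leb\<bar> \<le> (\<integral>s. \<bar>K t s\<bar> \<partial>unit_leb)"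
      by (rule integral_abs_bound)
    also have "\<dots> \<le> B"
      using K_section_integrable[OF that] B that
      by (intro L.integral_le_const) auto
    finally show ?thesis .
  qed
  with m show "integrable unit_leb (\<lambda>t. \<integral>s. K t s \<partial>unit_leb)"
    by (intro L.integrable_const_bound[where B = B]) auto
qed

section \<open>Second moments of the additive field and of its centering\<close>

lemma pair_prob_space_cube: "pair_prob_space (cube d) M"
  using prob_space_cube prob_space_axioms
  by (simp add: pair_prob_space_def pair_sigma_finite_def prob_space_imp_sigma_finite)

lemma Y_section_L2:
  assumes "\<And>j. j \<in> {1..d} \<Longrightarrow> t j \<in> {0..1}"
  shows "Y X d t \<in> L2 M"
  unfolding Y_def[abs_def] using assms by (intro L2_sum X_L2) auto

text \<open>The terms with \<open>j \<noteq> k\<close> of the double sum vanish because the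
  processes are uncorrelated. Only the coordinates in \<open>{1..d}\<close> are constrained, so the
  formula also covers grid points that are not elements of \<open>space (cube d)\<close>.\<close>

lemma Y_covariance:
  assumes "\<And>j. j \<in> {1..d} \<Longrightarrow> t j \<in> {0..1}" "\<And>j. j \<in> {1..d} \<Longrightarrow> s j \<in> {0..1}"
  shows "(\<integral>\<omega>. Y X d t \<omega> * Y X d s \<omega> \<partial>M) = (\<Sum>j=1..d. K (t j) (s j))"
proof -
  have i: "integrable M (\<lambda>\<omega>. X j (t j) \<omega> * X k (s k) \<omega>)" if "j \<in> {1..d}" "k \<in> {1..d}" for j k
    using assms that by (intro L2_integrable_mult X_L2) auto
  have "(\<integral>\<omega>. Y X d t \<omega> * Y X d s \<omega> \<partial>M)
    = (\<Sum>j=1..d. \<integral>\<omega>. (\<Sum>k=1..d. X j (t j) \<omega> * X k (s k) \<omega>) \<partial>M)"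
    unfolding Y_def sum_product
    by (rule Bochner_Integration.integral_sum) (rule Bochner_Integration.integrable_sum, rule i)
  also have "\<dots> = (\<Sum>j=1..d. \<Sum>k=1..d. \<integral>\<omega>. X j (t j) \<omega> * X k (s k) \<omega> \<partial>M)"
    by (rule sum.cong[OF refl], rule Bochner_Integration.integral_sum, rule i)
  also have "\<dots> = (\<Sum>j=1..d. \<Sum>k=1..d. if j = k then K (t j) (s j) else 0)"
    using assms by (intro sum.cong refl) (auto simp: X_covariance X_uncorrelated)
  finally show ?thesis
    by simp
qed

lemma
  assumes "t \<in> space (cube d)"
  shows Y_section_L2_cube: "Y X d t \<in> L2 M"
    and Y_covariance_cube: "s \<in> space (cube d) \<Longrightarrow>
      (\<integral>\<omega>. Y X d t \<omega> * Y X d s \<omega> \<partial>M) = (\<Sum>j=1..d. K (t j) (s j))"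
proof -
  have t: "t j \<in> {0..1}" if "j \<in> {1..d}" for j
    using assms that by (rule cube_coordinate)
  show "Y X d t \<in> L2 M"
    by (rule Y_section_L2) (rule t)
  assume s: "s \<in> space (cube d)"
  have "s j \<in> {0..1}" if "j \<in> {1..d}" for j
    using s that by (rule cube_coordinate)
  with t show "(\<integral>\<omega>. Y X d t \<omega> * Y X d s \<omega> \<partial>M) = (\<Sum>j=1..d. K (t j) (s j))"
    by (rule Y_covariance)
qed

text \<open>Each summand is treated by Fubini: its second moment at \<open>t\<close> is
  \<open>K (t j) (t j)\<close>, which is integrable over the cube.\<close>

lemma Y_L2: "case_prod (Y X d) \<in> L2 (cube d \<Otimes>\<^sub>M M)"
proof -
  interpret pair_prob_space "cube d" M by (rule pair_prob_space_cube)
  have "(\<lambda>p. X j (fst p j) (snd p)) \<in> L2 (cube d \<Otimes>\<^sub>M M)" if j: "j \<in> {1..d}" for j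
  proof -
    have j1: "j \<ge> 1"
      using j by simp
    have tj: "t j \<in> {0..1}" if "t \<in> space (cube d)" for t
      using that j by (rule cube_coordinate)
    have [measurable]: "(\<lambda>t. t j) \<in> cube d \<rightarrow>\<^sub>M unit_leb"
      by (rule measurable_cube_coordinate[OF j])
    have "(\<lambda>p. (fst p j, snd p)) \<in> cube d \<Otimes>\<^sub>M M \<rightarrow>\<^sub>M unit_leb \<Otimes>\<^sub>M M"
      by measurable
    from measurable_compose[OF this X_measurable[OF j1]]
    have m [measurable]: "(\<lambda>p. X j (fst p j) (snd p)) \<in> borel_measurable (cube d \<Otimes>\<^sub>M M)"
      by simp
    have "integrable (cube d \<Otimes>\<^sub>M M) (\<lambda>p. (X j (fst p j) (snd p))\<^sup>2)"
    proof (rule Fubini_integrable)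
      have "integrable (cube d) (\<lambda>t. K (t j) (t j))"
        using integrable_cube_coordinate[OF K_diagonal(1) j] K_diagonal(2) by (rule iffD2)
      moreover have "K (t j) (t j) = (\<integral>\<omega>. (X j (t j) \<omega>)\<^sup>2 \<partial>M)" if "t \<in> space (cube d)" for t
        using X_covariance[OF j1 tj[OF that] tj[OF that]] by (simp add: power2_eq_square)
      ultimately have "integrable (cube d) (\<lambda>t. \<integral>\<omega>. (X j (t j) \<omega>)\<^sup>2 \<partial>M)"
        by (rule Bochner_Integration.integrable_cong[OF refl, THEN iffD1, rotated])
      then show "integrable (cube d) (\<lambda>t. \<integral>\<omega>. norm ((X j (fst (t, \<omega>) j) (snd (t, \<omega>)))\<^sup>2) \<partial>M)"
        by simp
      show "AE t in cube d. integrable M (\<lambda>\<omega>. (X j (fst (t, \<omega>) j) (snd (t, \<omega>)))\<^sup>2)"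
        unfolding fst_conv snd_conv by (rule AE_I2) (rule X_square_integrable[OF j1 tj])
    qed measurable
    with m show ?thesis
      by (simp add: L2_def)
  qed
  then show ?thesis
    unfolding case_prod_beta' Y_def by (rule L2_sum)
qed

lemma Y_mean_square: "(\<integral>\<omega>. (l2_norm (cube d) (\<lambda>t. Y X d t \<omega>))\<^sup>2 \<partial>M) = d * Lambda K"
proof -
  interpret pair_prob_space "cube d" M by (rule pair_prob_space_cube)
  have "(\<integral>\<omega>. (l2_norm (cube d) (\<lambda>t. Y X d t \<omega>))\<^sup>2 \<partial>M) = (\<integral>t. (\<Sum>j=1..d. K (t j) (t j)) \<partial>cube d)"
    unfolding integrable_l2_norm_section(2)[OF Y_L2] unfolding power2_eq_square
    by (intro Bochner_Integration.integral_cong refl Y_covariance_cube)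
  also have "\<dots> = (\<Sum>j=1..d. \<integral>u. K u u \<partial>unit_leb)"
    using integrable_cube_coordinate[OF K_diagonal(1)] integral_cube_coordinate[OF K_diagonal(1)]
      K_diagonal(2)
    by (subst Bochner_Integration.integral_sum) auto
  finally show ?thesis
    by (simp add: Lambda_def)
qed

lemma Y_mean_square_mean: "(\<integral>\<omega>. (\<integral>t. Y X d t \<omega> \<partial>cube d)\<^sup>2 \<partial>M) = d * lambda0_bar K"
proof -
  interpret pair_prob_space "cube d" M by (rule pair_prob_space_cube)
  have "(\<integral>\<omega>. (\<integral>t. Y X d t \<omega> \<partial>cube d)\<^sup>2 \<partial>M)
    = (\<integral>t. (\<integral>s. (\<integral>\<omega>. Y X d t \<omega> * Y X d s \<omega> \<partial>M) \<partial>cube d) \<partial>cube d)"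
    by (rule integral_square_mean[OF Y_L2 Y_section_L2_cube])
  also have "\<dots> = (\<integral>t. (\<integral>s. (\<Sum>j=1..d. K (t j) (s j)) \<partial>cube d) \<partial>cube d)"
    by (intro Bochner_Integration.integral_cong refl Y_covariance_cube)
  also have "\<dots> = (\<integral>t. (\<Sum>j=1..d. \<integral>u. K (t j) u \<partial>unit_leb) \<partial>cube d)"
  proof (rule Bochner_Integration.integral_cong[OF refl])
    fix t assume "t \<in> space (cube d)"
    then have "t j \<in> {0..1}" if "j \<in> {1..d}" for j
      using that by (rule cube_coordinate)
    then show "(\<integral>s. (\<Sum>j=1..d. K (t j) (s j)) \<partial>cube d) = (\<Sum>j=1..d. \<integral>u. K (t j) u \<partial>unit_leb)"
      using integrable_cube_coordinate[OF K_section_measurable]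
        integral_cube_coordinate[OF K_section_measurable] K_section_integrable
      by (subst Bochner_Integration.integral_sum) auto
  qed
  also have "\<dots> = (\<Sum>j=1..d. \<integral>v. (\<integral>u. K v u \<partial>unit_leb) \<partial>unit_leb)"
    using integrable_cube_coordinate[OF K_mean(1)] integral_cube_coordinate[OF K_mean(1)] K_mean(2)
    by (subst Bochner_Integration.integral_sum) auto
  finally show ?thesis
    by (simp add: lambda0_bar_def)
qed

lemma Z_mean_square: "(\<integral>\<omega>. (l2_norm (cube d) (\<lambda>t. Z X d t \<omega>))\<^sup>2 \<partial>M) = d * Lambda_bar K"
proof -
  interpret pair_prob_space "cube d" M by (rule pair_prob_space_cube)
  show ?thesis
    unfolding Z_def integral_l2_norm_centered[OF Y_L2] Y_mean_square Y_mean_square_mean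
      Lambda_bar_def
    by (rule right_diff_distrib[symmetric])
qed

lemma avg_error_Y_0: "avg_error M (cube d) (Y X d) 0 = sqrt (d * Lambda K)"
  by (simp add: avg_error_def Y_mean_square del: One_nat_def)

lemma avg_error_Z_0: "avg_error M (cube d) (Z X d) 0 = sqrt (d * Lambda_bar K)"
  by (simp add: avg_error_def Z_mean_square del: One_nat_def)

text \<open>The case \<open>d = 1\<close> of \<open>Y_mean_square_mean\<close>, whose left side
  integrates a square.\<close>

lemma lambda0_bar_nonneg: "0 \<le> lambda0_bar K"
proof -
  have "0 \<le> real 1 * lambda0_bar K"
    unfolding Y_mean_square_mean[symmetric] by simp
  then show ?thesis
    by simp
qed

text \<open>Again the case \<open>d = 1\<close>, now of \<open>Z_mean_square\<close>.\<close>

lemma Lambda_bar_nonneg: "0 \<le> Lambda_bar K"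
proof -
  have "0 \<le> real 1 * Lambda_bar K"
    unfolding Z_mean_square[symmetric] by simp
  then show ?thesis
    by simp
qed

lemma Z_L2: "case_prod (Z X d) \<in> L2 (cube d \<Otimes>\<^sub>M M)"
proof -
  interpret pair_prob_space "cube d" M by (rule pair_prob_space_cube)
  have "(\<lambda>\<omega>. \<integral>t. Y X d t \<omega> \<partial>cube d) \<in> L2 M"
    using L2_inner_section[OF Y_L2 M1.L2_const[of 1]] by (simp add: l2_inner_def)
  then show ?thesis
    using L2_diff[OF Y_L2 L2_tensor[OF M1.L2_const[of 1]]] by (simp add: case_prod_beta' Z_def)
qed

section \<open>Errors and complexities of the two fields compared\<close>

lemma avg_error_Z_Suc_le:
  "n \<ge> 1 \<Longrightarrow> avg_error M (cube d) (Z X d) (Suc n) \<le> avg_error M (cube d) (Y X d) n"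
  using pair_prob_space.avg_error_shift[OF pair_prob_space_cube Y_L2, of n d
      "\<lambda>\<omega>. - (\<integral>s. Y X d s \<omega> \<partial>cube d)"]
  by (simp add: Z_def[abs_def])

lemma avg_error_Y_Suc_le:
  "n \<ge> 1 \<Longrightarrow> avg_error M (cube d) (Y X d) (Suc n) \<le> avg_error M (cube d) (Z X d) n"
  using pair_prob_space.avg_error_shift[OF pair_prob_space_cube Z_L2, of n d
      "\<lambda>\<omega>. \<integral>s. Y X d s \<omega> \<partial>cube d"]
  by (simp add: Z_def)

text \<open>Provides the admissible index without which the complexity would be unspecified. Each
  coordinate is rounded down to a grid of mesh \<open>1 / N\<close>. Since the field is additive,
  indicators depending on a single coordinate suffice, \<open>d * (N + 1)\<close> of them.\<close>

lemma avg_error_Y_small: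
  fixes \<delta> :: real
  assumes "\<delta> > 0" "d \<ge> 1"
  obtains n where "n \<ge> 1" "avg_error M (cube d) (Y X d) n \<le> sqrt (d * \<delta>)"
proof -
  interpret pair_prob_space "cube d" M by (rule pair_prob_space_cube)
  \<comment> \<open>The tolerance is \<open>\<delta> / 2\<close> because a mean square increment of
    a process splits into two differences of values of \<open>K\<close>.\<close>
  have "uniformly_continuous_on ({0..1} \<times> {0..1}) (\<lambda>(t, s). K t s)"
    by (rule compact_uniformly_continuous[OF K_continuous compact_Times]) simp_all
  then have "\<exists>r>0. \<forall>p\<in>{0..1} \<times> {0..1}. \<forall>q\<in>{0..1} \<times> {0..1}. dist q p < r \<longrightarrow>
      dist (case q of (t, s) \<Rightarrow> K t s) (case p of (t, s) \<Rightarrow> K t s) < \<delta> / 2"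
    unfolding uniformly_continuous_on_def using half_gt_zero[OF \<open>\<delta> > 0\<close>] by blast
  then obtain r where r: "r > 0"
    and uc: "\<forall>p\<in>{0..1} \<times> {0..1}. \<forall>q\<in>{0..1} \<times> {0..1}. dist q p < r \<longrightarrow>
      dist (case q of (t, s) \<Rightarrow> K t s) (case p of (t, s) \<Rightarrow> K t s) < \<delta> / 2"
    by blast
  obtain N where N: "N \<ge> 1" "1 / real N < r"
    using nat_approx_posE[OF r] by (metis One_nat_def Suc_le_mono le0)
  define \<tau> where "\<tau> k = real k / real N" for k
  \<comment> \<open>For \<open>u\<close> in the unit interval this is the index of the last grid
    point not exceeding \<open>u\<close>. The endpoint \<open>u = 1\<close> has index
    \<open>N\<close>, so the indices run over \<open>0..N\<close>.\<close>
  define \<kappa> where "\<kappa> u = nat \<lfloor>real N * u\<rfloor>" for u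
  have \<tau>: "\<tau> k \<in> {0..1}" if "k \<le> N" for k
    using that N by (simp add: \<tau>_def)
  have \<kappa>: "\<kappa> u \<le> N" "\<bar>u - \<tau> (\<kappa> u)\<bar> < r" if "u \<in> {0..1}" for u
  proof -
    have "real N * u \<le> real N * 1"
      using that by (intro mult_left_mono) auto
    then show "\<kappa> u \<le> N"
      unfolding \<kappa>_def by linarith
    have "real (\<kappa> u) \<le> real N * u" "real N * u < real (\<kappa> u) + 1"
      using that by (auto simp: \<kappa>_def)
    then have "\<tau> (\<kappa> u) \<le> u" "u < \<tau> (\<kappa> u) + 1 / N"
      using N by (simp_all add: \<tau>_def field_simps)
    then show "\<bar>u - \<tau> (\<kappa> u)\<bar> < r"
      using N by linarith
  qed
  \<comment> \<open>The left side is the mean square of \<open>X j u - X j v\<close> for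
    \<open>v = \<tau> (\<kappa> u)\<close> and any \<open>j \<ge> 1\<close>. Both
    \<open>(u, u)\<close> and \<open>(v, v)\<close> are compared with the mixed point
    \<open>(u, v)\<close>, from which each differs in one coordinate.\<close>
  have close: "K u u - 2 * K u (\<tau> (\<kappa> u)) + K (\<tau> (\<kappa> u)) (\<tau> (\<kappa> u)) \<le> \<delta>" if u: "u \<in> {0..1}" for u
  proof -
    let ?v = "\<tau> (\<kappa> u)"
    have v: "?v \<in> {0..1}"
      using \<tau> \<kappa>(1)[OF u] by blast
    have "dist (u, u) (u, ?v) < r" "dist (?v, ?v) (u, ?v) < r"
      using \<kappa>(2)[OF u] by (simp_all add: dist_Pair_Pair dist_real_def abs_minus_commute)
    then have "dist (K u u) (K u ?v) < \<delta> / 2" "dist (K ?v ?v) (K u ?v) < \<delta> / 2"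
      using uc[rule_format, of "(u, ?v)" "(u, u)"] uc[rule_format, of "(u, ?v)" "(?v, ?v)"] u v
      by auto
    then show ?thesis
      unfolding dist_real_def by linarith
  qed
  \<comment> \<open>The pair \<open>(j, k)\<close> stands for coordinate \<open>j\<close> lying in
    grid cell \<open>k\<close>: \<open>\<psi>\<close> is the indicator of that event and
    \<open>c\<close> the value of \<open>X j\<close> at the grid point.\<close>
  define I where "I = {1..d} \<times> {0..N}"
  define \<psi> where "\<psi> i t = (if \<kappa> (t (fst i)) = snd i then 1 else 0 :: real)"
    for i :: "nat \<times> nat" and t :: "nat \<Rightarrow> real"
  define c where "c i = X (fst i) (\<tau> (snd i))" for i
  define W where "W t \<omega> = Y X d t \<omega> - (\<Sum>i\<in>I. c i \<omega> * \<psi> i t)" for t \<omega>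
  have \<psi>: "\<psi> i \<in> L2 (cube d)" if "i \<in> I" for i
  proof -
    have "fst i \<in> {1..d}"
      using that by (auto simp: I_def)
    moreover have "(\<lambda>u. u) \<in> borel_measurable unit_leb"
      by (rule measurable_restrict_space1) simp
    ultimately have [measurable]: "(\<lambda>t. t (fst i)) \<in> borel_measurable (cube d)"
      by (rule measurable_compose[OF measurable_cube_coordinate])
    have m [measurable]: "\<psi> i \<in> borel_measurable (cube d)"
      unfolding \<psi>_def[abs_def] \<kappa>_def by measurable
    have "integrable (cube d) (\<lambda>t. (\<psi> i t)\<^sup>2)"
    proof (rule M1.integrable_const_bound[where B = 1])
      show "AE t in cube d. norm ((\<psi> i t)\<^sup>2) \<le> 1"
        by (simp add: \<psi>_def)
    qed measurable
    with m show ?thesis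
      by (simp add: L2_def)
  qed
  have c: "c i \<in> L2 M" if "i \<in> I" for i
    using that unfolding c_def I_def by (intro X_L2 \<tau>) auto
  have W: "case_prod W \<in> L2 (cube d \<Otimes>\<^sub>M M)"
    unfolding W_def[abs_def] by (intro L2_diff_tensor_sum Y_L2 \<psi> c)
  have W_small: "(\<integral>\<omega>. (W t \<omega>)\<^sup>2 \<partial>M) \<le> d * \<delta>" if t: "t \<in> space (cube d)" for t
  proof -
    define s where "s j = \<tau> (\<kappa> (t j))" for j
    have t01: "t j \<in> {0..1}" if "j \<in> {1..d}" for j
      using t that by (rule cube_coordinate)
    have s01: "s j \<in> {0..1}" if "j \<in> {1..d}" for j
      unfolding s_def using \<tau> \<kappa>(1) t01[OF that] by blast
    \<comment> \<open>For each coordinate exactly one cell contributes, so the approximation at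
      \<open>t\<close> is the field at the rounded point \<open>s\<close>.\<close>
    have "(\<Sum>i\<in>I. c i \<omega> * \<psi> i t) = Y X d s \<omega>" for \<omega>
    proof -
      have "(\<Sum>i\<in>I. c i \<omega> * \<psi> i t)
        = (\<Sum>j=1..d. \<Sum>k=0..N. if \<kappa> (t j) = k then X j (\<tau> k) \<omega> else 0)"
        unfolding I_def sum.cartesian_product
        by (intro sum.cong) (auto simp: c_def \<psi>_def)
      also have "\<dots> = (\<Sum>j=1..d. X j (s j) \<omega>)"
        using \<kappa>(1) t01 by (intro sum.cong) (auto simp: s_def)
      finally show ?thesis
        by (simp add: Y_def)
    qed
    then have "(\<integral>\<omega>. (W t \<omega>)\<^sup>2 \<partial>M) = (\<integral>\<omega>. Y X d t \<omega> * Y X d t \<omega>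
        - 2 * (Y X d t \<omega> * Y X d s \<omega>) + Y X d s \<omega> * Y X d s \<omega> \<partial>M)"
      by (simp add: W_def power2_eq_square algebra_simps)
    also have "\<dots> = (\<integral>\<omega>. Y X d t \<omega> * Y X d t \<omega> \<partial>M)
        - 2 * (\<integral>\<omega>. Y X d t \<omega> * Y X d s \<omega> \<partial>M) + (\<integral>\<omega>. Y X d s \<omega> * Y X d s \<omega> \<partial>M)"
      using L2_integrable_mult[OF Y_section_L2[OF t01] Y_section_L2[OF t01]]
        L2_integrable_mult[OF Y_section_L2[OF t01] Y_section_L2[OF s01]]
        L2_integrable_mult[OF Y_section_L2[OF s01] Y_section_L2[OF s01]]
      by simp
    also have "\<dots> = (\<Sum>j=1..d. K (t j) (t j) - 2 * K (t j) (s j) + K (s j) (s j))"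
    proof -
      have "(\<integral>\<omega>. Y X d t \<omega> * Y X d t \<omega> \<partial>M) = (\<Sum>j=1..d. K (t j) (t j))"
        using t01 t01 by (rule Y_covariance)
      moreover have "(\<integral>\<omega>. Y X d t \<omega> * Y X d s \<omega> \<partial>M) = (\<Sum>j=1..d. K (t j) (s j))"
        using t01 s01 by (rule Y_covariance)
      moreover have "(\<integral>\<omega>. Y X d s \<omega> * Y X d s \<omega> \<partial>M) = (\<Sum>j=1..d. K (s j) (s j))"
        using s01 s01 by (rule Y_covariance)
      ultimately show ?thesis
        by (simp add: sum.distrib sum_subtractf sum_distrib_left)
    qed
    also have "\<dots> \<le> (\<Sum>j=1..d. \<delta>)"
      unfolding s_def using close t01 by (intro sum_mono) blast
    finally show ?thesis
      by simp
  qed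
  have "avg_error M (cube d) (Y X d) (card I) \<le> sqrt (\<integral>\<omega>. (l2_norm (cube d) (\<lambda>t. W t \<omega>))\<^sup>2 \<partial>M)"
  proof (rule avg_error_le[where \<psi> = \<psi> and c = c])
    show "AE \<omega> in M. (\<lambda>t. Y X d t \<omega>) \<in> L2 (cube d)"
      by (rule L2_section[OF Y_L2])
    show "integrable M (\<lambda>\<omega>. (l2_norm (cube d) (\<lambda>t. W t \<omega>))\<^sup>2)"
      by (rule integrable_l2_norm_section(1)[OF W])
    show "finite I"
      by (simp add: I_def)
    show "\<psi> i \<in> L2 (cube d)" if "i \<in> I" for i
      using that by (rule \<psi>)
  qed (simp add: W_def)
  \<comment> \<open>The bound on the second moment of \<open>W t\<close> is uniform in
    \<open>t\<close>, and averaging over the cube, a probability space, preserves it.\<close>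
  also have "(\<integral>\<omega>. (l2_norm (cube d) (\<lambda>t. W t \<omega>))\<^sup>2 \<partial>M) \<le> d * \<delta>"
    unfolding integrable_l2_norm_section(2)[OF W]
    using integrable_l2_norm_section(3)[OF W] W_small
    by (intro M1.integral_le_const) auto
  finally have "avg_error M (cube d) (Y X d) (card I) \<le> sqrt (d * \<delta>)"
    by simp
  moreover have "card I \<ge> 1"
    using \<open>d \<ge> 1\<close> by (simp add: I_def)
  ultimately show thesis
    using that by blast
qed

text \<open>Both relative thresholds amount to the same absolute one, so the error inequalities with
  \<open>Suc n\<close> cost one index in either direction. Raising the threshold to
  \<open>\<epsilon>'\<close> keeps an admissible index admissible.\<close>

lemma avg_complexity_bounds:
  assumes "Lambda_bar K \<noteq> 0" "\<epsilon> > 0" "d \<ge> 1"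
  shows "avg_complexity M (cube d) (Y X d) \<epsilon> \<le> avg_complexity M (cube d) (Z X d) (\<epsilon> / eps0 K) + 1"
    and "\<epsilon> / eps0 K \<le> \<epsilon>' \<Longrightarrow>
      avg_complexity M (cube d) (Z X d) \<epsilon>' \<le> avg_complexity M (cube d) (Y X d) \<epsilon> + 1"
proof -
  let ?nY = "avg_complexity M (cube d) (Y X d) \<epsilon>"
  let ?nZ = "avg_complexity M (cube d) (Z X d) (\<epsilon> / eps0 K)"
  have pos: "Lambda_bar K > 0" "Lambda K > 0"
    using assms(1) Lambda_bar_nonneg lambda0_bar_nonneg by (simp_all add: Lambda_bar_def)
  \<comment> \<open>\<open>eps0 K\<close> is the ratio of the initial errors of \<open>Z X d\<close>
    and \<open>Y X d\<close>; the factor \<open>sqrt d\<close> cancels.\<close>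
  have scale: "\<epsilon> / eps0 K * avg_error M (cube d) (Z X d) 0 = \<epsilon> * avg_error M (cube d) (Y X d) 0"
    using pos unfolding avg_error_Y_0 avg_error_Z_0
    by (simp add: eps0_def real_sqrt_divide real_sqrt_mult)
  \<comment> \<open>With this value as \<open>\<delta>\<close>, the bound
    \<open>sqrt (d * \<delta>)\<close> is exactly \<open>\<epsilon>\<close> times the initial error
    of \<open>Y X d\<close>.\<close>
  have "\<epsilon>\<^sup>2 * Lambda K > 0"
    using assms pos by simp
  then obtain n where n: "n \<ge> 1" "avg_error M (cube d) (Y X d) n \<le> sqrt (d * (\<epsilon>\<^sup>2 * Lambda K))"
    using avg_error_Y_small assms(3) by blast
  have "sqrt (d * (\<epsilon>\<^sup>2 * Lambda K)) = \<epsilon> * avg_error M (cube d) (Y X d) 0"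
    unfolding avg_error_Y_0 using assms by (simp add: real_sqrt_mult)
  with n have nY: "avg_error M (cube d) (Y X d) n \<le> \<epsilon> * avg_error M (cube d) (Y X d) 0"
    by simp
  note Y_at = avg_complexity_attained[OF n(1) nY]
  \<comment> \<open>An admissible index for \<open>Z X d\<close> is inherited from
    \<open>Y X d\<close>, so its complexity is attained as well.\<close>
  have "avg_error M (cube d) (Z X d) (Suc n) \<le> \<epsilon> / eps0 K * avg_error M (cube d) (Z X d) 0"
    unfolding scale using avg_error_Z_Suc_le[OF n(1)] nY by (rule order_trans)
  from avg_complexity_attained[OF _ this]
  have Z_at: "?nZ \<ge> 1" "avg_error M (cube d) (Z X d) ?nZ \<le> \<epsilon> * avg_error M (cube d) (Y X d) 0"
    unfolding scale by simp_all
  have "avg_error M (cube d) (Y X d) (Suc ?nZ) \<le> \<epsilon> * avg_error M (cube d) (Y X d) 0"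
    using avg_error_Y_Suc_le[OF Z_at(1)] Z_at(2) by (rule order_trans)
  then show "?nY \<le> ?nZ + 1"
    using avg_complexity_le[of "Suc ?nZ"] by simp
  assume \<epsilon>': "\<epsilon> / eps0 K \<le> \<epsilon>'"
  have "avg_error M (cube d) (Z X d) (Suc ?nY) \<le> \<epsilon> / eps0 K * avg_error M (cube d) (Z X d) 0"
    unfolding scale using avg_error_Z_Suc_le[OF Y_at(1)] Y_at(2) by (rule order_trans)
  also have "\<dots> \<le> \<epsilon>' * avg_error M (cube d) (Z X d) 0"
    unfolding avg_error_Z_0 using \<epsilon>' pos by (intro mult_right_mono) simp_all
  finally show "avg_complexity M (cube d) (Z X d) \<epsilon>' \<le> ?nY + 1"
    using avg_complexity_le[of "Suc ?nY"] by simp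
qed

text \<open>The upper bound is \<open>lambda0_bar K \<ge> 0\<close>; positivity combines
  \<open>Lambda_bar K \<ge> 0\<close> with the hypothesis.\<close>

lemma eps0_bounds: "Lambda_bar K \<noteq> 0 \<Longrightarrow> eps0 K \<in> {0<..1}"
  using Lambda_bar_nonneg lambda0_bar_nonneg by (auto simp: eps0_def Lambda_bar_def)

end

theorem theorem1:
  fixes M :: "'a measure"
    and X :: "nat \<Rightarrow> real \<Rightarrow> 'a \<Rightarrow> real"
    and K :: "real \<Rightarrow> real \<Rightarrow> real"
  assumes "prob_space M"
    and "\<And>j. j \<ge> 1 \<Longrightarrow> (\<lambda>(t, \<omega>). X j t \<omega>) \<in> borel_measurable (unit_leb \<Otimes>\<^sub>M M)"
    and "\<And>j. j \<ge> 1 \<Longrightarrow> AE \<omega> in M. (\<lambda>t. X j t \<omega>) \<in> L2 unit_leb"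
    and "\<And>j t. j \<ge> 1 \<Longrightarrow> t \<in> {0..1} \<Longrightarrow> integrable M (\<lambda>\<omega>. (X j t \<omega>)\<^sup>2)"
    and "\<And>j t. j \<ge> 1 \<Longrightarrow> t \<in> {0..1} \<Longrightarrow> (\<integral>\<omega>. X j t \<omega> \<partial>M) = 0"
    and "\<And>j t s. j \<ge> 1 \<Longrightarrow> t \<in> {0..1} \<Longrightarrow> s \<in> {0..1} \<Longrightarrow>
           (\<integral>\<omega>. X j t \<omega> * X j s \<omega> \<partial>M) = K t s"
    and "continuous_on ({0..1} \<times> {0..1}) (\<lambda>(t, s). K t s)"
    and "\<And>j k t s. j \<ge> 1 \<Longrightarrow> k \<ge> 1 \<Longrightarrow> j \<noteq> k \<Longrightarrow> t \<in> {0..1} \<Longrightarrow> s \<in> {0..1} \<Longrightarrow>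
           (\<integral>\<omega>. X j t \<omega> * X k s \<omega> \<partial>M) = 0"
    and "Lambda_bar K \<noteq> 0"
  shows "eps0 K \<in> {0<..1} \<and>
    (\<forall>\<epsilon>\<in>{0<..<eps0 K}. \<forall>d\<ge>1.
       int (avg_complexity M (cube d) (Z X d) (\<epsilon> / eps0 K + real d powr (- 1 / 2))) - 1
         \<le> int (avg_complexity M (cube d) (Y X d) \<epsilon>)
     \<and> int (avg_complexity M (cube d) (Y X d) \<epsilon>)
         \<le> int (avg_complexity M (cube d) (Z X d) (\<epsilon> / eps0 K)) + 1)"
proof -
  interpret prob_space M by fact
  interpret uncorrelated_process M X K
    by unfold_locales (fact assms)+
  show ?thesis
  proof (intro conjI ballI allI impI)
    show "eps0 K \<in> {0<..1}"
      using assms(9) by (rule eps0_bounds)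
    fix \<epsilon> :: real and d :: nat
    assume "\<epsilon> \<in> {0<..<eps0 K}" and d: "d \<ge> 1"
    then have "\<epsilon> > 0"
      by simp
    note bounds = avg_complexity_bounds[OF assms(9) this d]
    have "avg_complexity M (cube d) (Z X d) (\<epsilon> / eps0 K + real d powr (- 1 / 2))
        \<le> avg_complexity M (cube d) (Y X d) \<epsilon> + 1"
      \<comment> \<open>The added power of \<open>d\<close> is nonnegative, so the argument is at
        least \<open>\<epsilon> / eps0 K\<close>.\<close>
      by (rule bounds(2)) simp
    then show "int (avg_complexity M (cube d) (Z X d) (\<epsilon> / eps0 K + real d powr (- 1 / 2))) - 1
        \<le> int (avg_complexity M (cube d) (Y X d) \<epsilon>)"
      by linarith
    show "int (avg_complexity M (cube d) (Y X d) \<epsilon>)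
        \<le> int (avg_complexity M (cube d) (Z X d) (\<epsilon> / eps0 K)) + 1"
      using bounds(1) by linarith
  qed
qed

end
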